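(* Let $(Q_1,N_1)$ and $(Q_2,N_2)$ be two classical solutions of system (S) (with possibly different initial data). Then, as long as both solutions exist, $$\frac{d}{d\tau}\int_0^1\bigl(P_0(Q_1)-P_0(Q_2)\bigr)^2d\eta=2\int_0^1P_0(Q_1-Q_2)\,P_0\bigl(K(Q_1)-K(Q_2)\bigr)\,d\eta .$$ In particular, if $K$ is of the form $K(Q)=kQ+b$ with constants $k,b$, then $$\frac{d}{d\tau}\int_0^1\bigl(P_0(Q_1)-P_0(Q_2)\bigr)^2d\eta=2k\int_0^1\bigl(P_0(Q_1)-P_0(Q_2)\bigr)^2d\eta,$$ which implies $$\|P_0Q_1(\tau)-P_0Q_2(\tau)\|_{L^2(0,1)}=e^{k\tau}\|P_0Q_1(0)-P_0Q_2(0)\|_{L^2(0,1)}$$ whenever the two classical solutions exist up to time $\tau$.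
   Context: Standing assumptions: $\Phi_F>0$ is fixed and $K\in C^2(\mathbb{R})$ is a function with $K',K''$ bounded on $\mathbb{R}$ and $K(\phi)>0$ for $\phi\in[0,\Phi_F]$. Notation: for an integrable function $f$ on $[0,1]$, $(P_0f)(\eta):=f(\eta)-\int_0^1f(\tilde\eta)\,d\tilde\eta$. For functions of $(\tau,\eta)$, $P_0$ acts on the variable $\eta$ for each fixed $\tau$. System (S), for unknowns $Q(\tau,\eta)$ and $N(\tau)$: $$\partial_\tau Q+\partial_\eta Q=\frac1{N(\tau)}+K(Q)\quad(\tau>0,\ \eta\in(0,1)),\qquad Q(\tau,0)=0\quad(\tau>0),$$ $$\frac1{N(\tau)}=\partial_\eta Q(\tau,1)-K(\Phi_F)\quad(\tau>0),\qquad Q(0,\eta)=Q_{\mathrm{init}}(\eta)\quad(\eta\in[0,1]).$$ Classical solution: given $0<T\le+\infty$ and an initial datum $Q_{\mathrm{init}}\in C^1[0,1]$ that is increasing with $Q_{\mathrm{init}}(0)=0$, $Q_{\mathrm{init}}(1)=\Phi_F$ and $\frac{d}{d\eta}Q_{\mathrm{init}}(1)>K(\Phi_F)$, a pair $(Q,N)$ is a classical solution of (S) on $[0,T)$ if (1) $Q\in C^1([0,T)\times[0,1])$ is increasing in $\eta$ and $N\in C[0,T)$ is positive; (2) the equations of (S) hold in the classical sense for $\tau\in[0,T)$; (3) $K(\Phi_F)<\partial_\eta Q(\tau,1)<+\infty$ for all $\tau\in[0,T)$. Here "increasing" means non-decreasing. *)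

theory Defs
  imports "HOL-Analysis.Analysis"
begin

definition P0 :: "(real \<Rightarrow> real) \<Rightarrow> real \<Rightarrow> real" where
  "P0 f \<eta> = f \<eta> - integral {0..1} f"

definition L2_norm_01 :: "(real \<Rightarrow> real) \<Rightarrow> real" where
  "L2_norm_01 f = sqrt (integral {0<..<1} (\<lambda>\<eta>. (f \<eta>)\<^sup>2))"

(* The half-open interval [0,T), where T may be infinity. *)
definition time_interval :: "ereal \<Rightarrow> real set" where
  "time_interval T = {\<tau>. 0 \<le> \<tau> \<and> ereal \<tau> < T}"

(* All derivatives are taken within the domain, hence are one-sided at its boundary:
   values of Q and Qinit outside the domain are irrelevant. *)

definition d_tau :: "ereal \<Rightarrow> (real \<Rightarrow> real \<Rightarrow> real) \<Rightarrow> real \<Rightarrow> real \<Rightarrow> real" where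
  "d_tau T Q \<tau> \<eta> = vector_derivative (\<lambda>s. Q s \<eta>) (at \<tau> within time_interval T)"

definition d_eta :: "(real \<Rightarrow> real) \<Rightarrow> real \<Rightarrow> real" where
  "d_eta f \<eta> = vector_derivative f (at \<eta> within {0..1})"

definition C1_unit_interval :: "(real \<Rightarrow> real) \<Rightarrow> bool" where
  "C1_unit_interval f \<longleftrightarrow> f differentiable_on {0..1} \<and> continuous_on {0..1} (d_eta f)"

definition C1_strip :: "ereal \<Rightarrow> (real \<Rightarrow> real \<Rightarrow> real) \<Rightarrow> bool" where
  "C1_strip T Q \<longleftrightarrow>
     (\<forall>\<eta>\<in>{0..1}. (\<lambda>\<tau>. Q \<tau> \<eta>) differentiable_on time_interval T) \<and>
     (\<forall>\<tau>\<in>time_interval T. Q \<tau> differentiable_on {0..1}) \<and>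
     continuous_on (time_interval T \<times> {0..1}) (\<lambda>(\<tau>, \<eta>). Q \<tau> \<eta>) \<and>
     continuous_on (time_interval T \<times> {0..1}) (\<lambda>(\<tau>, \<eta>). d_tau T Q \<tau> \<eta>) \<and>
     continuous_on (time_interval T \<times> {0..1}) (\<lambda>(\<tau>, \<eta>). d_eta (Q \<tau>) \<eta>)"

definition C2_bounded_derivs :: "(real \<Rightarrow> real) \<Rightarrow> bool" where
  "C2_bounded_derivs K \<longleftrightarrow>
     (\<forall>x. K field_differentiable at x) \<and>
     (\<forall>x. deriv K field_differentiable at x) \<and>
     continuous_on UNIV (deriv (deriv K)) \<and>
     bounded (range (deriv K)) \<and>
     bounded (range (deriv (deriv K)))"

definition admissible_datum :: "real \<Rightarrow> (real \<Rightarrow> real) \<Rightarrow> (real \<Rightarrow> real) \<Rightarrow> bool" where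
  "admissible_datum \<Phi>F K Qinit \<longleftrightarrow>
     C1_unit_interval Qinit \<and>
     mono_on {0..1} Qinit \<and>
     Qinit 0 = 0 \<and>
     Qinit 1 = \<Phi>F \<and>
     d_eta Qinit 1 > K \<Phi>F"

(* The equations are imposed up to time 0, where the time derivative is one-sided; given the
   C^1 regularity of Q and the continuity of N this is the same as imposing them for positive
   times only. *)
definition classical_solution ::
    "real \<Rightarrow> (real \<Rightarrow> real) \<Rightarrow> (real \<Rightarrow> real) \<Rightarrow> ereal \<Rightarrow>
     (real \<Rightarrow> real \<Rightarrow> real) \<Rightarrow> (real \<Rightarrow> real) \<Rightarrow> bool" where
  "classical_solution \<Phi>F K Qinit T Q N \<longleftrightarrow>
     0 < T \<and>
     admissible_datum \<Phi>F K Qinit \<and>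
     C1_strip T Q \<and>
     (\<forall>\<tau>\<in>time_interval T. mono_on {0..1} (Q \<tau>)) \<and>
     continuous_on (time_interval T) N \<and>
     (\<forall>\<tau>\<in>time_interval T. N \<tau> > 0) \<and>
     (\<forall>\<tau>\<in>time_interval T. \<forall>\<eta>\<in>{0<..<1}.
        d_tau T Q \<tau> \<eta> + d_eta (Q \<tau>) \<eta> = 1 / N \<tau> + K (Q \<tau> \<eta>)) \<and>
     (\<forall>\<tau>\<in>time_interval T. Q \<tau> 0 = 0) \<and>
     (\<forall>\<tau>\<in>time_interval T. 1 / N \<tau> = d_eta (Q \<tau>) 1 - K \<Phi>F) \<and>
     (\<forall>\<eta>\<in>{0..1}. Q 0 \<eta> = Qinit \<eta>) \<and>
     (\<forall>\<tau>\<in>time_interval T. K \<Phi>F < d_eta (Q \<tau>) 1)"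

end

theory Submission
  imports Defs
begin

text \<open>
  Write \<open>w = Q1 - Q2\<close> and \<open>E = \<integral> (P0 w)\<^sup>2\<close> over the unit interval. Differentiating under the integral
  and using that \<open>P0\<close> is a symmetric projection gives \<open>E' = 2 \<integral> P0 w \<cdot> \<partial>\<^sub>\<tau> w\<close>
  (\<open>P0_energy_has_derivative\<close>). The two equations yield
  \<open>\<partial>\<^sub>\<tau> w = c(\<tau>) + (K(Q1) - K(Q2)) - \<partial>\<^sub>\<eta> w\<close>, where \<open>c = 1/N1 - 1/N2\<close> does not depend on \<open>\<eta>\<close>.
  The term \<open>c\<close> is orthogonal to \<open>P0 w\<close>, which has mean zero. The transport term is the exact
  derivative of \<open>(P0 w)\<^sup>2 / 2\<close> and integrates to zero as soon as \<open>w\<close> takes the same value at both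
  ends of the interval (\<open>P0_transport_integral\<close>). What remains is the claimed right-hand side.

  At \<open>\<eta> = 0\<close> both solutions vanish. At \<open>\<eta> = 1\<close> no boundary value is prescribed, but both solutions
  equal \<open>\<Phi>F\<close> there (\<open>classical_solution_right_end\<close>): the formula for \<open>1/N\<close> cancels \<open>\<partial>\<^sub>\<eta> Q\<close> in the
  equation at \<open>\<eta> = 1\<close>, so \<open>y = Q(\<cdot>,1)\<close> solves the ordinary differential equation
  \<open>y' = K(y) - K(\<Phi>F)\<close> with \<open>y(0) = \<Phi>F\<close>, whose only solution is the constant since \<open>K\<close> is
  Lipschitz continuous.

  For affine \<open>K\<close> with slope \<open>k\<close> the identity reads \<open>E' = 2 k E\<close>, so \<open>E(\<tau>) exp(-2 k \<tau>)\<close> is constant.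
\<close>

section \<open>The projection onto mean-zero functions\<close>

lemma P0_diff:
  assumes "f integrable_on {0..1}" "g integrable_on {0..1}"
  shows "P0 (\<lambda>x. f x - g x) x = P0 f x - P0 g x"
  using assms by (simp add: P0_def integral_diff)

lemma P0_cmult: "P0 (\<lambda>x. k * f x) x = k * P0 f x"
  by (simp add: P0_def algebra_simps)

lemma continuous_on_P0:
  "continuous_on {0..1} f \<Longrightarrow> continuous_on {0..1} (P0 f)"
  unfolding P0_def by (intro continuous_intros)

lemma integral_P0_eq_0:
  assumes "continuous_on {0..1} f"
  shows "integral {0..1} (P0 f) = 0"
proof -
  have "P0 f = (\<lambda>x. f x - integral {0..1} f)"
    by (simp add: P0_def fun_eq_iff)
  then show ?thesis
    using assms by (simp add: integral_diff integrable_continuous_real)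
qed

lemma integral_P0_mult:
  assumes f: "continuous_on {0..1} f" and g: "continuous_on {0..1} g"
  shows "integral {0..1} (\<lambda>x. P0 f x * g x)
           = integral {0..1} (\<lambda>x. f x * g x) - integral {0..1} f * integral {0..1} g"
proof -
  have "(\<lambda>x. P0 f x * g x) = (\<lambda>x. f x * g x - integral {0..1} f * g x)"
    by (simp add: P0_def algebra_simps)
  moreover have "(\<lambda>x. f x * g x) integrable_on {0..1}" "(\<lambda>x. integral {0..1} f * g x) integrable_on {0..1}"
    by (intro integrable_continuous_real continuous_intros f g)+
  ultimately show ?thesis
    by (simp add: integral_diff)
qed

text \<open>The correction made by the second projection is a constant, which is orthogonal to the
  mean-zero function \<open>P0 f\<close>.\<close>

lemma integral_P0_mult_P0:
  assumes f: "continuous_on {0..1} f" and g: "continuous_on {0..1} g"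
  shows "integral {0..1} (\<lambda>x. P0 f x * P0 g x) = integral {0..1} (\<lambda>x. P0 f x * g x)"
proof -
  have "integral {0..1} (\<lambda>x. P0 f x * P0 g x)
          = integral {0..1} (\<lambda>x. P0 f x * g x - integral {0..1} g * P0 f x)"
    by (simp add: P0_def[of g] algebra_simps)
  also have "\<dots> = integral {0..1} (\<lambda>x. P0 f x * g x) - integral {0..1} g * integral {0..1} (P0 f)"
    by (subst integral_diff)
      (auto intro!: integrable_continuous_real continuous_intros continuous_on_P0 f g)
  finally show ?thesis
    by (simp add: integral_P0_eq_0 f)
qed

text \<open>The integrand is the derivative of \<open>(P0 f)\<^sup>2 / 2\<close>, since \<open>P0 f\<close> and \<open>f\<close> have the same derivative.\<close>

lemma P0_transport_integral:
  assumes f: "\<And>x. x \<in> {0..1} \<Longrightarrow> (f has_real_derivative f' x) (at x within {0..1})"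
    and ends: "f 0 = f 1"
  shows "((\<lambda>x. P0 f x * f' x) has_integral 0) {0..1}"
proof -
  have "((\<lambda>x. (P0 f x)\<^sup>2 / 2) has_vector_derivative P0 f x * f' x) (at x within {0..1})"
    if "x \<in> {0..1}" for x
    unfolding P0_def has_real_derivative_iff_has_vector_derivative[symmetric]
    by (rule derivative_eq_intros f that refl | simp)+
  from fundamental_theorem_of_calculus[OF _ this]
  have "((\<lambda>x. P0 f x * f' x) has_integral ((P0 f 1)\<^sup>2 / 2 - (P0 f 0)\<^sup>2 / 2)) {0..1}"
    by simp
  then show ?thesis
    using ends by (simp add: P0_def)
qed

lemma slice_continuous:
  assumes "continuous_on (U \<times> V) (\<lambda>(s, x). F s x)" "s \<in> U"
  shows "continuous_on V (F s)"
  using continuous_on_compose2[OF assms(1), of V "\<lambda>x. (s, x)"] assms(2)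
  by (force intro: continuous_intros)

text \<open>Both \<open>\<integral> w\<^sup>2\<close> and \<open>\<integral> w\<close> can be differentiated under the integral, and the energy of \<open>P0 w\<close> is
  \<open>\<integral> w\<^sup>2 - (\<integral> w)\<^sup>2\<close>.\<close>

lemma P0_energy_has_derivative:
  fixes w :: "real \<Rightarrow> real \<Rightarrow> real"
  assumes U: "convex U" "t \<in> U"
    and w: "\<And>s x. s \<in> U \<Longrightarrow> x \<in> {0..1} \<Longrightarrow>
              ((\<lambda>s. w s x) has_real_derivative wt s x) (at s within U)"
    and cw: "continuous_on (U \<times> {0..1}) (\<lambda>(s, x). w s x)"
    and cwt: "continuous_on (U \<times> {0..1}) (\<lambda>(s, x). wt s x)"
  shows "((\<lambda>s. integral {0..1} (\<lambda>x. (P0 (w s) x)\<^sup>2)) has_real_derivative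
           2 * integral {0..1} (\<lambda>x. P0 (w t) x * wt t x)) (at t within U)"
proof -
  have cws: "continuous_on {0..1} (w s)" if "s \<in> U" for s
    using cw that by (rule slice_continuous)
  have cwts: "continuous_on {0..1} (wt s)" if "s \<in> U" for s
    using cwt that by (rule slice_continuous)
  have D1: "((\<lambda>s. integral {0..1} (w s)) has_real_derivative integral {0..1} (wt t)) (at t within U)"
    using leibniz_rule_field_derivative[of U 0 1 w wt t] U w cwt cws
    by (simp add: integrable_continuous_real)
  have "((\<lambda>s. integral (cbox 0 1) (\<lambda>x. w s x * w s x)) has_real_derivative
           integral (cbox 0 1) (\<lambda>x. 2 * (w t x * wt t x))) (at t within U)"
  proof (rule leibniz_rule_field_derivative)
    show "((\<lambda>s. w s x * w s x) has_real_derivative 2 * (w s x * wt s x)) (at s within U)"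
      if "s \<in> U" "x \<in> cbox 0 1" for s x
      using that by (auto intro!: derivative_eq_intros w)
    show "(\<lambda>x. w s x * w s x) integrable_on cbox 0 1" if "s \<in> U" for s
      using that by (auto intro!: integrable_continuous_real continuous_intros cws)
    show "continuous_on (U \<times> cbox 0 1) (\<lambda>(s, x). 2 * (w s x * wt s x))"
      using continuous_on_mult_left[OF continuous_on_mult[OF cw cwt], of 2]
      by (simp add: case_prod_unfold)
  qed (use U in auto)
  then have D2: "((\<lambda>s. integral {0..1} (\<lambda>x. w s x * w s x)) has_real_derivative
           2 * integral {0..1} (\<lambda>x. w t x * wt t x)) (at t within U)"
    by simp
  have "((\<lambda>s. integral {0..1} (\<lambda>x. w s x * w s x) - integral {0..1} (w s) * integral {0..1} (w s))
           has_real_derivative 2 * integral {0..1} (\<lambda>x. P0 (w t) x * wt t x)) (at t within U)"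
    by (auto intro!: derivative_eq_intros D1 D2 simp: integral_P0_mult cws cwts U)
  moreover have "integral {0..1} (\<lambda>x. w s x * w s x) - integral {0..1} (w s) * integral {0..1} (w s)
                   = integral {0..1} (\<lambda>x. (P0 (w s) x)\<^sup>2)" if "s \<in> U" for s
    using integral_P0_mult_P0[of "w s" "w s"] integral_P0_mult[of "w s" "w s"] cws that
    by (simp add: power2_eq_square)
  ultimately show ?thesis
    unfolding has_real_derivative_iff_has_vector_derivative
    by - (erule has_vector_derivative_transform[OF U(2), rotated], simp)
qed

section \<open>Uniqueness at a stationary point\<close>

text \<open>With \<open>u = y - a\<close> one has \<open>(u\<^sup>2)' \<le> 2 L u\<^sup>2\<close>, so \<open>u\<^sup>2 exp(-2 L t)\<close> is non-increasing,
  non-negative and zero at the initial time.\<close>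

lemma lipschitz_ode_stays_at_rest:
  fixes y y' :: "real \<Rightarrow> real"
  assumes y: "\<And>s. s \<in> {0..t} \<Longrightarrow> (y has_real_derivative y' s) (at s within {0..t})"
    and lip: "\<And>s. s \<in> {0..t} \<Longrightarrow> \<bar>y' s\<bar> \<le> L * \<bar>y s - a\<bar>"
    and "y 0 = a" "0 \<le> t"
  shows "y t = a"
proof -
  define g where "g s = (y s - a)\<^sup>2 * exp (- (2 * L * s))" for s
  have g: "(g has_real_derivative (2 * ((y s - a) * y' s) - 2 * (L * (y s - a)\<^sup>2)) * exp (- (2 * L * s)))
             (at s within {0..t})" if "s \<in> {0..t}" for s
    unfolding g_def
    by (auto intro!: derivative_eq_intros y[OF that] simp: algebra_simps power2_eq_square)
  have "g t \<le> g 0"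
  proof (rule DERIV_nonpos_imp_decreasing_open[where f = g])
    show "continuous_on {0..t} g"
      using g by (rule DERIV_continuous_on)
    fix s assume s: "0 < s" "s < t"
    have "(y s - a) * y' s \<le> \<bar>y s - a\<bar> * \<bar>y' s\<bar>"
      by (simp flip: abs_mult)
    also have "\<dots> \<le> \<bar>y s - a\<bar> * (L * \<bar>y s - a\<bar>)"
      using lip s by (intro mult_left_mono) auto
    also have "\<dots> = L * (y s - a)\<^sup>2"
      by (simp add: power2_eq_square)
    finally have "(2 * ((y s - a) * y' s) - 2 * (L * (y s - a)\<^sup>2)) * exp (- (2 * L * s)) \<le> 0"
      by (simp add: mult_le_0_iff)
    moreover have "at s within {0..t} = at s"
      using s by (simp add: at_within_Icc_at)
    ultimately show "\<exists>d. DERIV g s :> d \<and> d \<le> 0"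
      using g[of s] s by auto
  qed (use assms in auto)
  then show ?thesis
    using \<open>y 0 = a\<close> by (simp add: g_def mult_le_0_iff)
qed

lemma C2_bounded_derivs_has_deriv:
  assumes "C2_bounded_derivs K"
  shows "(K has_real_derivative deriv K x) (at x)"
  using assms unfolding C2_bounded_derivs_def by (simp add: field_differentiable_derivI)

lemma C2_bounded_derivs_continuous:
  assumes "C2_bounded_derivs K"
  shows "continuous_on S K"
  by (rule DERIV_continuous_on)
    (rule has_field_derivative_at_within[OF C2_bounded_derivs_has_deriv[OF assms]])

lemma C2_bounded_derivs_lipschitz:
  assumes "C2_bounded_derivs K"
  obtains L where "\<And>x y. \<bar>K x - K y\<bar> \<le> L * \<bar>x - y\<bar>"
proof -
  have "bounded (range (deriv K))"
    using assms by (simp add: C2_bounded_derivs_def)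
  then obtain L where L: "\<And>x. norm (deriv K x) \<le> L"
    unfolding bounded_iff by auto
  have "norm (K x - K y) \<le> L * norm (x - y)" for x y
    by (rule field_differentiable_bound[OF convex_UNIV C2_bounded_derivs_has_deriv[OF assms] L UNIV_I UNIV_I])
  then have "\<bar>K x - K y\<bar> \<le> L * \<bar>x - y\<bar>" for x y
    by (simp only: real_norm_def)
  then show thesis
    by (rule that)
qed

section \<open>Classical solutions\<close>

lemma time_interval_downward:
  assumes "b \<in> time_interval T" "0 \<le> x" "x \<le> b"
  shows "x \<in> time_interval T"
proof -
  have "ereal x \<le> ereal b" "ereal b < T"
    using assms by (simp_all add: time_interval_def)
  then have "ereal x < T"
    by (rule le_less_trans)
  then show ?thesis
    using assms by (simp add: time_interval_def)
qed

lemma Icc_subset_time_interval: "\<tau> \<in> time_interval T \<Longrightarrow> {0..\<tau>} \<subseteq> time_interval T"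
  by (auto intro: time_interval_downward[of \<tau>])

lemma convex_time_interval: "convex (time_interval T)"
proof (rule is_interval_convex, unfold is_interval_1, intro ballI allI impI)
  fix a b x
  assume "a \<in> time_interval T" "b \<in> time_interval T" "a \<le> x \<and> x \<le> b"
  then show "x \<in> time_interval T"
    by - (rule time_interval_downward[of b], auto simp: time_interval_def)
qed

lemma time_interval_mono: "S \<le> T \<Longrightarrow> time_interval S \<subseteq> time_interval T"
  by (auto simp: time_interval_def)

lemma zero_in_time_interval: "0 < T \<Longrightarrow> 0 \<in> time_interval T"
  by (simp add: time_interval_def zero_ereal_def)

context
  fixes \<Phi>F :: real and K Qinit :: "real \<Rightarrow> real" and T :: ereal
    and Q :: "real \<Rightarrow> real \<Rightarrow> real" and N :: "real \<Rightarrow> real"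
  assumes sol: "classical_solution \<Phi>F K Qinit T Q N"
begin

lemma classical_solution_facts:
  shows classical_solution_T_pos: "0 < T"
    and classical_solution_datum: "admissible_datum \<Phi>F K Qinit"
    and classical_solution_C1: "C1_strip T Q"
    and classical_solution_equation: "\<forall>\<tau>\<in>time_interval T. \<forall>\<eta>\<in>{0<..<1}.
        d_tau T Q \<tau> \<eta> + d_eta (Q \<tau>) \<eta> = 1 / N \<tau> + K (Q \<tau> \<eta>)"
    and classical_solution_left_end: "\<forall>\<tau>\<in>time_interval T. Q \<tau> 0 = 0"
    and classical_solution_N: "\<forall>\<tau>\<in>time_interval T. 1 / N \<tau> = d_eta (Q \<tau>) 1 - K \<Phi>F"
    and classical_solution_initial: "\<forall>\<eta>\<in>{0..1}. Q 0 \<eta> = Qinit \<eta>"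
  using sol unfolding classical_solution_def by - (elim conjE, assumption)+

lemma classical_solution_continuous:
  "continuous_on (time_interval T \<times> {0..1}) (\<lambda>(\<tau>, \<eta>). Q \<tau> \<eta>)"
  "continuous_on (time_interval T \<times> {0..1}) (\<lambda>(\<tau>, \<eta>). d_tau T Q \<tau> \<eta>)"
  "continuous_on (time_interval T \<times> {0..1}) (\<lambda>(\<tau>, \<eta>). d_eta (Q \<tau>) \<eta>)"
  using classical_solution_C1 unfolding C1_strip_def by - (elim conjE, assumption)+

lemma classical_solution_has_d_tau:
  assumes "\<tau> \<in> time_interval T" "\<eta> \<in> {0..1}"
  shows "((\<lambda>s. Q s \<eta>) has_real_derivative d_tau T Q \<tau> \<eta>) (at \<tau> within time_interval T)"
proof -
  have "(\<lambda>s. Q s \<eta>) differentiable_on time_interval T"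
    using classical_solution_C1 assms(2) unfolding C1_strip_def by fast
  then have "(\<lambda>s. Q s \<eta>) differentiable (at \<tau> within time_interval T)"
    using assms(1) unfolding differentiable_on_def by fast
  then show ?thesis
    unfolding d_tau_def has_real_derivative_iff_has_vector_derivative
    by (simp only: vector_derivative_works)
qed

lemma classical_solution_has_d_eta:
  assumes "\<tau> \<in> time_interval T" "\<eta> \<in> {0..1}"
  shows "(Q \<tau> has_real_derivative d_eta (Q \<tau>) \<eta>) (at \<eta> within {0..1})"
proof -
  have "Q \<tau> differentiable_on {0..1}"
    using classical_solution_C1 assms(1) unfolding C1_strip_def by fast
  then have "Q \<tau> differentiable (at \<eta> within {0..1})"
    using assms(2) unfolding differentiable_on_def by fast
  then show ?thesis
    unfolding d_eta_def has_real_derivative_iff_has_vector_derivative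
    by (simp only: vector_derivative_works)
qed

context
  assumes K: "C2_bounded_derivs K"
begin

text \<open>All terms of the equation are continuous on the closed unit interval, so it extends from the
  interior to the end points.\<close>

lemma classical_solution_equation_closed:
  assumes \<tau>: "\<tau> \<in> time_interval T" and \<eta>: "\<eta> \<in> {0..1}"
  shows "d_tau T Q \<tau> \<eta> = 1 / N \<tau> + K (Q \<tau> \<eta>) - d_eta (Q \<tau>) \<eta>"
proof -
  define h where "h x = d_tau T Q \<tau> x + d_eta (Q \<tau>) x - K (Q \<tau> x)" for x
  have cont: "continuous_on {0..1} (Q \<tau>)" "continuous_on {0..1} (d_tau T Q \<tau>)"
    "continuous_on {0..1} (d_eta (Q \<tau>))"
    using classical_solution_continuous[THEN slice_continuous, OF \<tau>] by - (assumption+)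
  have "continuous_on {0..1} (\<lambda>x. K (Q \<tau> x))"
    by (rule continuous_on_compose2[OF C2_bounded_derivs_continuous[OF K, of UNIV] cont(1)]) simp
  then have "continuous_on {0..1} h"
    unfolding h_def by (intro continuous_on_add continuous_on_diff cont)
  moreover have "h x = 1 / N \<tau>" if "x \<in> {0<..<1}" for x
    using bspec[OF bspec[OF classical_solution_equation \<tau>] that] by (simp add: h_def)
  ultimately have "h \<eta> = 1 / N \<tau>"
    using continuous_constant_on_closure[of "{0<..<1}" h "1 / N \<tau>" \<eta>] \<eta> by simp
  then show ?thesis
    by (simp add: h_def)
qed

text \<open>At \<open>\<eta> = 1\<close> the definition of \<open>N\<close> turns the equation into \<open>y' = K(y) - K(\<Phi>F)\<close> for \<open>y = Q(\<cdot>,1)\<close>,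
  which starts at its stationary point \<open>\<Phi>F\<close>.\<close>

lemma classical_solution_right_end:
  assumes \<tau>: "\<tau> \<in> time_interval T"
  shows "Q \<tau> 1 = \<Phi>F"
proof -
  obtain L where L: "\<And>x y. \<bar>K x - K y\<bar> \<le> L * \<bar>x - y\<bar>"
    using C2_bounded_derivs_lipschitz[OF K] by blast
  have sub: "{0..\<tau>} \<subseteq> time_interval T"
    by (rule Icc_subset_time_interval[OF \<tau>])
  have eq: "d_tau T Q s 1 = K (Q s 1) - K \<Phi>F" if "s \<in> {0..\<tau>}" for s
  proof -
    have s: "s \<in> time_interval T"
      using that sub by blast
    then have "1 / N s = d_eta (Q s) 1 - K \<Phi>F"
      by (rule bspec[OF classical_solution_N])
    then show ?thesis
      using classical_solution_equation_closed[OF s, of 1] by simp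
  qed
  show ?thesis
  proof (rule lipschitz_ode_stays_at_rest[where y = "\<lambda>s. Q s 1"])
    show "((\<lambda>s. Q s 1) has_real_derivative d_tau T Q s 1) (at s within {0..\<tau>})"
      if "s \<in> {0..\<tau>}" for s
      using that sub by (intro has_field_derivative_subset[OF classical_solution_has_d_tau sub]) auto
    show "\<bar>d_tau T Q s 1\<bar> \<le> L * \<bar>Q s 1 - \<Phi>F\<bar>" if "s \<in> {0..\<tau>}" for s
      using eq[OF that] L by simp
    show "Q 0 1 = \<Phi>F"
      using classical_solution_initial classical_solution_datum by (simp add: admissible_datum_def)
    show "0 \<le> \<tau>"
      using \<tau> by (simp add: time_interval_def)
  qed
qed

end

end

section \<open>The energy of the difference of two solutions\<close>

theorem P0_energy_identity:
  assumes K: "C2_bounded_derivs K"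
    and sol1: "classical_solution \<Phi>F K Qinit1 T1 Q1 N1"
    and sol2: "classical_solution \<Phi>F K Qinit2 T2 Q2 N2"
    and \<tau>: "\<tau> \<in> time_interval (min T1 T2)"
  shows "((\<lambda>s. integral {0..1} (\<lambda>\<eta>. (P0 (Q1 s) \<eta> - P0 (Q2 s) \<eta>)\<^sup>2)) has_real_derivative
            2 * integral {0..1} (\<lambda>\<eta>. P0 (\<lambda>x. Q1 \<tau> x - Q2 \<tau> x) \<eta> *
                                      P0 (\<lambda>x. K (Q1 \<tau> x) - K (Q2 \<tau> x)) \<eta>))
           (at \<tau> within time_interval (min T1 T2))"
proof -
  let ?U = "time_interval (min T1 T2)"
  define w where "w s x = Q1 s x - Q2 s x" for s x
  define wt where "wt s x = d_tau T1 Q1 s x - d_tau T2 Q2 s x" for s x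
  define wx where "wx x = d_eta (Q1 \<tau>) x - d_eta (Q2 \<tau>) x" for x
  define D where "D x = K (Q1 \<tau> x) - K (Q2 \<tau> x)" for x
  define c where "c = 1 / N1 \<tau> - 1 / N2 \<tau>"
  have U1: "?U \<subseteq> time_interval T1" and U2: "?U \<subseteq> time_interval T2"
    by (simp_all add: time_interval_mono)
  note \<tau>1 = subsetD[OF U1 \<tau>] and \<tau>2 = subsetD[OF U2 \<tau>]
  note cont1 = classical_solution_continuous[OF sol1] and cont2 = classical_solution_continuous[OF sol2]
  have cQ1: "continuous_on {0..1} (Q1 s)" and cQ2: "continuous_on {0..1} (Q2 s)" if "s \<in> ?U" for s
    by (rule slice_continuous[OF cont1(1) subsetD[OF U1 that]])
      (rule slice_continuous[OF cont2(1) subsetD[OF U2 that]])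
  have cw: "continuous_on {0..1} (w \<tau>)"
    unfolding w_def by (intro continuous_on_diff cQ1 cQ2 \<tau>)
  have cD: "continuous_on {0..1} D"
    unfolding D_def
    by (intro continuous_on_diff subset_UNIV
        continuous_on_compose2[OF C2_bounded_derivs_continuous[OF K, of UNIV] cQ1[OF \<tau>]]
        continuous_on_compose2[OF C2_bounded_derivs_continuous[OF K, of UNIV] cQ2[OF \<tau>]])
  have "((\<lambda>s. integral {0..1} (\<lambda>x. (P0 (w s) x)\<^sup>2)) has_real_derivative
           2 * integral {0..1} (\<lambda>x. P0 (w \<tau>) x * wt \<tau> x)) (at \<tau> within ?U)"
  proof (rule P0_energy_has_derivative[OF convex_time_interval \<tau>])
    show "((\<lambda>s. w s x) has_real_derivative wt s x) (at s within ?U)"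
      if "s \<in> ?U" "x \<in> {0..1}" for s x
      unfolding w_def wt_def
      by (intro DERIV_diff
          has_field_derivative_subset[OF classical_solution_has_d_tau[OF sol1 _ that(2)] U1]
          has_field_derivative_subset[OF classical_solution_has_d_tau[OF sol2 _ that(2)] U2]
          subsetD[OF U1 that(1)] subsetD[OF U2 that(1)])
    have sub: "?U \<times> {0..1::real} \<subseteq> time_interval T1 \<times> {0..1}" "?U \<times> {0..1::real} \<subseteq> time_interval T2 \<times> {0..1}"
      using U1 U2 by auto
    show "continuous_on (?U \<times> {0..1}) (\<lambda>(s, x). w s x)"
      using continuous_on_diff[OF continuous_on_subset[OF cont1(1) sub(1)]
          continuous_on_subset[OF cont2(1) sub(2)]]
      by (simp add: w_def case_prod_unfold)
    show "continuous_on (?U \<times> {0..1}) (\<lambda>(s, x). wt s x)"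
      using continuous_on_diff[OF continuous_on_subset[OF cont1(2) sub(1)]
          continuous_on_subset[OF cont2(2) sub(2)]]
      by (simp add: wt_def case_prod_unfold)
  qed
  moreover have "integral {0..1} (\<lambda>x. (P0 (w s) x)\<^sup>2)
                   = integral {0..1} (\<lambda>x. (P0 (Q1 s) x - P0 (Q2 s) x)\<^sup>2)" if "s \<in> ?U" for s
    using cQ1[OF that] cQ2[OF that] unfolding w_def
    by (simp add: P0_diff integrable_continuous_real)
  ultimately have "((\<lambda>s. integral {0..1} (\<lambda>x. (P0 (Q1 s) x - P0 (Q2 s) x)\<^sup>2)) has_real_derivative
           2 * integral {0..1} (\<lambda>x. P0 (w \<tau>) x * wt \<tau> x)) (at \<tau> within ?U)"
    unfolding has_real_derivative_iff_has_vector_derivative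
    by - (erule has_vector_derivative_transform[OF \<tau>, rotated], simp)
  moreover have "integral {0..1} (\<lambda>x. P0 (w \<tau>) x * wt \<tau> x)
                   = integral {0..1} (\<lambda>x. P0 (w \<tau>) x * P0 D x)"
  proof -
    have "((\<lambda>x. P0 (w \<tau>) x * wx x) has_integral 0) {0..1}"
    proof (rule P0_transport_integral)
      show "(w \<tau> has_real_derivative wx x) (at x within {0..1})" if "x \<in> {0..1}" for x
        unfolding w_def wx_def
        by (intro DERIV_diff classical_solution_has_d_eta[OF sol1 \<tau>1 that]
            classical_solution_has_d_eta[OF sol2 \<tau>2 that])
      show "w \<tau> 0 = w \<tau> 1"
        using bspec[OF classical_solution_left_end[OF sol1] \<tau>1]
          bspec[OF classical_solution_left_end[OF sol2] \<tau>2]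
          classical_solution_right_end[OF sol1 K \<tau>1] classical_solution_right_end[OF sol2 K \<tau>2]
        by (simp add: w_def)
    qed
    moreover have "((\<lambda>x. P0 (w \<tau>) x * D x) has_integral integral {0..1} (\<lambda>x. P0 (w \<tau>) x * P0 D x)) {0..1}"
      unfolding integral_P0_mult_P0[OF cw cD]
      by (intro integrable_integral integrable_continuous_real continuous_intros continuous_on_P0 cw cD)
    moreover have "((\<lambda>x. c * P0 (w \<tau>) x) has_integral c * integral {0..1} (P0 (w \<tau>))) {0..1}"
      by (intro has_integral_mult_right integrable_integral integrable_continuous_real continuous_on_P0 cw)
    ultimately have "((\<lambda>x. c * P0 (w \<tau>) x + P0 (w \<tau>) x * D x - P0 (w \<tau>) x * wx x) has_integral
        c * integral {0..1} (P0 (w \<tau>)) + integral {0..1} (\<lambda>x. P0 (w \<tau>) x * P0 D x) - 0) {0..1}"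
      by (intro has_integral_diff has_integral_add)
    moreover have "c * P0 (w \<tau>) x + P0 (w \<tau>) x * D x - P0 (w \<tau>) x * wx x = P0 (w \<tau>) x * wt \<tau> x"
      if "x \<in> {0..1}" for x
    proof -
      have "wt \<tau> x = c + D x - wx x"
        using classical_solution_equation_closed[OF sol1 K \<tau>1 that]
          classical_solution_equation_closed[OF sol2 K \<tau>2 that]
        by (simp add: wt_def c_def D_def wx_def)
      then show ?thesis
        by (simp only:) (simp add: algebra_simps)
    qed
    ultimately have "((\<lambda>x. P0 (w \<tau>) x * wt \<tau> x) has_integral
        c * integral {0..1} (P0 (w \<tau>)) + integral {0..1} (\<lambda>x. P0 (w \<tau>) x * P0 D x) - 0) {0..1}"
      by (rule has_integral_eq[rotated])
    then have "((\<lambda>x. P0 (w \<tau>) x * wt \<tau> x) has_integral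
        integral {0..1} (\<lambda>x. P0 (w \<tau>) x * P0 D x)) {0..1}"
      by (simp add: integral_P0_eq_0[OF cw])
    then show ?thesis
      by (rule integral_unique)
  qed
  ultimately show ?thesis
    by (simp add: w_def[abs_def] D_def[abs_def])
qed

text \<open>The constant part of an affine \<open>K\<close> cancels in \<open>K(Q1) - K(Q2)\<close>.\<close>

corollary P0_energy_identity_affine:
  assumes K: "C2_bounded_derivs K"
    and sol1: "classical_solution \<Phi>F K Qinit1 T1 Q1 N1"
    and sol2: "classical_solution \<Phi>F K Qinit2 T2 Q2 N2"
    and aff: "\<And>x. K x = k * x + b"
    and \<tau>: "\<tau> \<in> time_interval (min T1 T2)"
  shows "((\<lambda>s. integral {0..1} (\<lambda>\<eta>. (P0 (Q1 s) \<eta> - P0 (Q2 s) \<eta>)\<^sup>2)) has_real_derivative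
            2 * k * integral {0..1} (\<lambda>\<eta>. (P0 (Q1 \<tau>) \<eta> - P0 (Q2 \<tau>) \<eta>)\<^sup>2))
           (at \<tau> within time_interval (min T1 T2))"
proof -
  have \<tau>1: "\<tau> \<in> time_interval T1" and \<tau>2: "\<tau> \<in> time_interval T2"
    using \<tau> by (simp_all add: time_interval_def)
  have "Q1 \<tau> integrable_on {0..1}"
    by (rule integrable_continuous_real[OF
        slice_continuous[OF classical_solution_continuous(1)[OF sol1] \<tau>1]])
  moreover have "Q2 \<tau> integrable_on {0..1}"
    by (rule integrable_continuous_real[OF
        slice_continuous[OF classical_solution_continuous(1)[OF sol2] \<tau>2]])
  ultimately have "P0 (\<lambda>x. Q1 \<tau> x - Q2 \<tau> x) \<eta> * P0 (\<lambda>x. K (Q1 \<tau> x) - K (Q2 \<tau> x)) \<eta>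
               = k * (P0 (Q1 \<tau>) \<eta> - P0 (Q2 \<tau>) \<eta>)\<^sup>2" for \<eta>
    using P0_cmult[of k "\<lambda>x. Q1 \<tau> x - Q2 \<tau> x" \<eta>]
    by (simp add: aff P0_diff power2_eq_square flip: right_diff_distrib)
  then show ?thesis
    using P0_energy_identity[OF K sol1 sol2 \<tau>] by (simp add: mult.assoc)
qed

lemma linear_ode_solution:
  fixes E :: "real \<Rightarrow> real"
  assumes "convex U" and E: "\<And>s. s \<in> U \<Longrightarrow> (E has_real_derivative a * E s) (at s within U)"
    and "0 \<in> U" "t \<in> U"
  shows "E t = exp (a * t) * E 0"
proof -
  have "((\<lambda>s. E s * exp (- (a * s))) has_real_derivative 0) (at s within U)" if "s \<in> U" for s
    by (auto intro!: derivative_eq_intros E[OF that])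
  then obtain c where "\<And>s. s \<in> U \<Longrightarrow> E s * exp (- (a * s)) = c"
    using has_field_derivative_zero_constant[OF \<open>convex U\<close>, of "\<lambda>s. E s * exp (- (a * s))"] by blast
  from this[OF \<open>0 \<in> U\<close>] this[OF \<open>t \<in> U\<close>] show ?thesis
    by (simp add: exp_minus divide_simps mult.commute)
qed

theorem theorem4p2:
  fixes \<Phi>F :: real and K :: "real \<Rightarrow> real"
    and Qinit1 Qinit2 :: "real \<Rightarrow> real" and T1 T2 :: ereal
    and Q1 Q2 :: "real \<Rightarrow> real \<Rightarrow> real" and N1 N2 :: "real \<Rightarrow> real"
  assumes "\<Phi>F > 0"
    and "C2_bounded_derivs K"
    and "\<forall>\<phi>\<in>{0..\<Phi>F}. K \<phi> > 0"
    and "classical_solution \<Phi>F K Qinit1 T1 Q1 N1"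
    and "classical_solution \<Phi>F K Qinit2 T2 Q2 N2"
  shows "(\<forall>\<tau>\<in>time_interval (min T1 T2).
            ((\<lambda>s. integral {0..1} (\<lambda>\<eta>. (P0 (Q1 s) \<eta> - P0 (Q2 s) \<eta>)\<^sup>2))
               has_real_derivative
             2 * integral {0..1} (\<lambda>\<eta>. P0 (\<lambda>x. Q1 \<tau> x - Q2 \<tau> x) \<eta> *
                                       P0 (\<lambda>x. K (Q1 \<tau> x) - K (Q2 \<tau> x)) \<eta>))
            (at \<tau> within time_interval (min T1 T2)))
       \<and> (\<forall>k b. (\<forall>x. K x = k * x + b) \<longrightarrow>
            (\<forall>\<tau>\<in>time_interval (min T1 T2).
               ((\<lambda>s. integral {0..1} (\<lambda>\<eta>. (P0 (Q1 s) \<eta> - P0 (Q2 s) \<eta>)\<^sup>2))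
                  has_real_derivative
                2 * k * integral {0..1} (\<lambda>\<eta>. (P0 (Q1 \<tau>) \<eta> - P0 (Q2 \<tau>) \<eta>)\<^sup>2))
               (at \<tau> within time_interval (min T1 T2)))
          \<and> (\<forall>\<tau>\<in>time_interval (min T1 T2).
               L2_norm_01 (\<lambda>\<eta>. P0 (Q1 \<tau>) \<eta> - P0 (Q2 \<tau>) \<eta>)
                 = exp (k * \<tau>) * L2_norm_01 (\<lambda>\<eta>. P0 (Q1 0) \<eta> - P0 (Q2 0) \<eta>)))"
proof -
  note K = \<open>C2_bounded_derivs K\<close>
  note sols = assms(4,5)
  let ?U = "time_interval (min T1 T2)"
  define E where "E s = integral {0..1} (\<lambda>\<eta>. (P0 (Q1 s) \<eta> - P0 (Q2 s) \<eta>)\<^sup>2)" for s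
  have norm_E: "L2_norm_01 (\<lambda>\<eta>. P0 (Q1 s) \<eta> - P0 (Q2 s) \<eta>) = sqrt (E s)" for s
    by (simp add: L2_norm_01_def E_def integral_open_interval_real)
  have zero: "0 \<in> ?U"
    using classical_solution_T_pos[OF sols(1)] classical_solution_T_pos[OF sols(2)]
    by (simp add: zero_in_time_interval)
  have growth: "L2_norm_01 (\<lambda>\<eta>. P0 (Q1 \<tau>) \<eta> - P0 (Q2 \<tau>) \<eta>)
                  = exp (k * \<tau>) * L2_norm_01 (\<lambda>\<eta>. P0 (Q1 0) \<eta> - P0 (Q2 0) \<eta>)"
    if aff: "\<And>x. K x = k * x + b" and \<tau>: "\<tau> \<in> ?U" for k b \<tau>
  proof -
    have "E \<tau> = exp (2 * k * \<tau>) * E 0"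
      using P0_energy_identity_affine[OF K sols aff] unfolding E_def
      by (intro linear_ode_solution[OF convex_time_interval _ zero \<tau>]) auto
    also have "\<dots> = (exp (k * \<tau>))\<^sup>2 * E 0"
      by (simp add: power2_eq_square flip: exp_add)
    finally show ?thesis
      by (simp add: norm_E real_sqrt_mult)
  qed
  show ?thesis
    using P0_energy_identity[OF K sols] P0_energy_identity_affine[OF K sols] growth by blast
qed

end
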